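(* Let $\Gamma=\mathrm{SC}(G,R,L,S)$ be a semi-Cayley graph over a finite abelian group $G$ of order $n$, and let $\alpha,\beta$ be nonzero complex numbers. Let $X=\{z\in G:\chi_z(S)=0\}$. Then $(\alpha,\beta)$-revival occurs on $\Gamma$ from a vertex $u=(g,0)$ to a vertex $v=(h,0)$ at time $t$ if and only if the following hold: (a) $a=g^{-1}h$ has order two (and hence $n$ is even); (b) with $G_0=\{z\in G:\chi_a(z)=1\}$ and $G_1=\{z\in G:\chi_a(z)=-1\}$: for every $z\in G_0$, $\exp(\imath t\lambda_z^+)=\alpha+\beta$; for every $z\in G_1$, $\exp(\imath t\lambda_z^+)=\alpha-\beta$; for every $z\in G_0\setminus X$, $\exp(\imath t\lambda_z^-)=\alpha+\beta$; and for every $z\in G_1\setminus X$, $\exp(\imath t\lambda_z^-)=\alpha-\beta$.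
   Context: $G$ is a finite abelian group of order $n$, written multiplicatively with identity $1$, identified with $\mathbb{Z}_{n_1}\otimes\cdots\otimes\mathbb{Z}_{n_r}$. For $z=(z_1,\dots,z_r)$ and $g=(g_1,\dots,g_r)$ in $G$, the character $\chi_z$ is $\chi_z(g)=\prod_{s=1}^r\omega_{n_s}^{z_sg_s}$ with $\omega_m=\exp(2\pi\imath/m)$; note $\chi_z(g)=\chi_g(z)$. For $Y\subseteq G$, $\chi_z(Y)=\sum_{y\in Y}\chi_z(y)$. $R,L,S\subseteq G$ with $R=R^{-1}$, $L=L^{-1}$, $1\notin R\cup L$. The semi-Cayley graph $\mathrm{SC}(G,R,L,S)$ has vertex set $\{(g,0),(g,1):g\in G\}$ and edges $\{(g,0),(h,0)\}$ for $hg^{-1}\in R$, $\{(g,1),(h,1)\}$ for $hg^{-1}\in L$, $\{(g,0),(h,1)\}$ for $hg^{-1}\in S$. For $z\in G$, $\lambda_z^\pm=\frac12\left(\chi_z(R)+\chi_z(L)\pm\sqrt{(\chi_z(R)-\chi_z(L))^2+4|\chi_z(S)|^2}\right)$ (these are the eigenvalues of $\Gamma$). The transition matrix is $H(t)=\exp(\imath tA)$, $A$ the adjacency matrix. For distinct vertices $u,v$, $(\alpha,\beta)$-revival occurs from $u$ to $v$ at time $t$ if $H(t)\mathbf{e}_u=\alpha\mathbf{e}_u+\beta\mathbf{e}_v$ with $|\alpha|^2+|\beta|^2=1$.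
   Formalization: For z in X (where χ_z(S)=0) the square root in λ_z^± is read as χ_z(R)−χ_z(L), so λ_z^+=χ_z(R) and λ_z^−=χ_z(L); with the non-negative root the claim fails, e.g. for |G|=2, R=S=∅, L={a}, t=π/2. *)

theory Defs
  imports "HOL-Analysis.Analysis" "HOL-Algebra.Algebra"
begin

section \<open>Characters of a finite abelian group\<close>

text \<open>
  The identification of \<open>G\<close> with a product of cyclic groups is an explicit isomorphism \<open>\<phi>\<close> onto
  \<open>product_group {..<r} (\<lambda>s. integer_mod_group (ns s))\<close>, so \<open>\<phi> g s\<close> is the coordinate \<open>g\<^sub>s\<close>,
  an integer in \<open>{0..<ns s}\<close>.
\<close>

definition root_of_unity :: "nat \<Rightarrow> complex" where
  "root_of_unity m = exp (2 * of_real pi * \<i> / of_nat m)"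

definition chi :: "nat \<Rightarrow> (nat \<Rightarrow> nat) \<Rightarrow> ('a \<Rightarrow> nat \<Rightarrow> int) \<Rightarrow> 'a \<Rightarrow> 'a \<Rightarrow> complex" where
  "chi r ns \<phi> z g = (\<Prod>s<r. root_of_unity (ns s) powi (\<phi> z s * \<phi> g s))"

definition chi_sum :: "nat \<Rightarrow> (nat \<Rightarrow> nat) \<Rightarrow> ('a \<Rightarrow> nat \<Rightarrow> int) \<Rightarrow> 'a \<Rightarrow> 'a set \<Rightarrow> complex" where
  "chi_sum r ns \<phi> z Y = (\<Sum>y\<in>Y. chi r ns \<phi> z y)"

section \<open>Semi-Cayley graphs\<close>

text \<open>Edges are unordered, i.e. sets of vertices.\<close>

definition sc_verts :: "('a, 'm) monoid_scheme \<Rightarrow> ('a \<times> nat) set" where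
  "sc_verts G = carrier G \<times> {0, 1}"

definition sc_edges ::
  "('a, 'm) monoid_scheme \<Rightarrow> 'a set \<Rightarrow> 'a set \<Rightarrow> 'a set \<Rightarrow> ('a \<times> nat) set set" where
  "sc_edges G R L S =
     {{(g, 0), (h, 0)} | g h. g \<in> carrier G \<and> h \<in> carrier G \<and> h \<otimes>\<^bsub>G\<^esub> inv\<^bsub>G\<^esub> g \<in> R} \<union>
     {{(g, 1), (h, 1)} | g h. g \<in> carrier G \<and> h \<in> carrier G \<and> h \<otimes>\<^bsub>G\<^esub> inv\<^bsub>G\<^esub> g \<in> L} \<union>
     {{(g, 0), (h, 1)} | g h. g \<in> carrier G \<and> h \<in> carrier G \<and> h \<otimes>\<^bsub>G\<^esub> inv\<^bsub>G\<^esub> g \<in> S}"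

text \<open>
  The formula for \<open>\<lambda>\<^sub>z\<^sup>\<plusminus>\<close> contains the square root of
  \<open>(\<chi>\<^sub>z(R) - \<chi>\<^sub>z(L))\<^sup>2 + 4 |\<chi>\<^sub>z(S)|\<^sup>2\<close>. For \<open>\<chi>\<^sub>z(S) \<noteq> 0\<close> it is the principal one.
  For \<open>\<chi>\<^sub>z(S) = 0\<close> the radicand is the square of \<open>\<chi>\<^sub>z(R) - \<chi>\<^sub>z(L)\<close>, and that root is taken, so that
  \<open>\<lambda>\<^sub>z\<^sup>+ = \<chi>\<^sub>z(R)\<close> and \<open>\<lambda>\<^sub>z\<^sup>- = \<chi>\<^sub>z(L)\<close> are the eigenvalues of the eigenvectors supported on the
  layers \<open>0\<close> and \<open>1\<close> respectively. With the principal root instead, the labels would be swapped when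
  \<open>\<chi>\<^sub>z(R) < \<chi>\<^sub>z(L)\<close>, and a revival criterion for layer \<open>0\<close> that drops \<open>\<lambda>\<^sub>z\<^sup>-\<close> at the zeros of
  \<open>\<chi>\<^sub>z(S)\<close> would be false (e.g. \<open>G\<close> of order two with \<open>R = S = {}\<close> and \<open>L\<close> the non-identity
  element). The unordered pair \<open>{\<lambda>\<^sub>z\<^sup>+, \<lambda>\<^sub>z\<^sup>-}\<close> does not depend on this choice; see
  \<open>sc_eig_pair\<close> below.
\<close>

definition sc_radicand ::
  "nat \<Rightarrow> (nat \<Rightarrow> nat) \<Rightarrow> ('a \<Rightarrow> nat \<Rightarrow> int) \<Rightarrow> 'a set \<Rightarrow> 'a set \<Rightarrow> 'a set \<Rightarrow> 'a \<Rightarrow> complex" where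
  "sc_radicand r ns \<phi> R L S z =
     (chi_sum r ns \<phi> z R - chi_sum r ns \<phi> z L)\<^sup>2 + 4 * of_real ((cmod (chi_sum r ns \<phi> z S))\<^sup>2)"

definition sc_root ::
  "nat \<Rightarrow> (nat \<Rightarrow> nat) \<Rightarrow> ('a \<Rightarrow> nat \<Rightarrow> int) \<Rightarrow> 'a set \<Rightarrow> 'a set \<Rightarrow> 'a set \<Rightarrow> 'a \<Rightarrow> complex" where
  "sc_root r ns \<phi> R L S z =
     (if chi_sum r ns \<phi> z S = 0 then chi_sum r ns \<phi> z R - chi_sum r ns \<phi> z L
      else csqrt (sc_radicand r ns \<phi> R L S z))"

definition sc_eig_plus ::
  "nat \<Rightarrow> (nat \<Rightarrow> nat) \<Rightarrow> ('a \<Rightarrow> nat \<Rightarrow> int) \<Rightarrow> 'a set \<Rightarrow> 'a set \<Rightarrow> 'a set \<Rightarrow> 'a \<Rightarrow> complex" where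
  "sc_eig_plus r ns \<phi> R L S z =
     1/2 * (chi_sum r ns \<phi> z R + chi_sum r ns \<phi> z L + sc_root r ns \<phi> R L S z)"

definition sc_eig_minus ::
  "nat \<Rightarrow> (nat \<Rightarrow> nat) \<Rightarrow> ('a \<Rightarrow> nat \<Rightarrow> int) \<Rightarrow> 'a set \<Rightarrow> 'a set \<Rightarrow> 'a set \<Rightarrow> 'a \<Rightarrow> complex" where
  "sc_eig_minus r ns \<phi> R L S z =
     1/2 * (chi_sum r ns \<phi> z R + chi_sum r ns \<phi> z L - sc_root r ns \<phi> R L S z)"

lemma sc_root_cases:
  "sc_root r ns \<phi> R L S z = csqrt (sc_radicand r ns \<phi> R L S z) \<or>
   sc_root r ns \<phi> R L S z = - csqrt (sc_radicand r ns \<phi> R L S z)"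
proof (cases "chi_sum r ns \<phi> z S = 0")
  case True
  then have "(sc_root r ns \<phi> R L S z)\<^sup>2 = (csqrt (sc_radicand r ns \<phi> R L S z))\<^sup>2"
    by (simp add: sc_root_def sc_radicand_def)
  then show ?thesis
    by (simp only: power2_eq_iff)
qed (simp add: sc_root_def)

lemma sc_eig_pair:
  "{sc_eig_plus r ns \<phi> R L S z, sc_eig_minus r ns \<phi> R L S z} =
   {1/2 * (chi_sum r ns \<phi> z R + chi_sum r ns \<phi> z L + csqrt (sc_radicand r ns \<phi> R L S z)),
    1/2 * (chi_sum r ns \<phi> z R + chi_sum r ns \<phi> z L - csqrt (sc_radicand r ns \<phi> R L S z))}"
  using sc_root_cases[of r ns \<phi> R L S z]
  by (elim disjE) (auto simp: sc_eig_plus_def sc_eig_minus_def)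

section \<open>Transition matrix and fractional revival\<close>

text \<open>
  A complex matrix with rows and columns indexed by a finite set \<open>V\<close> is a function of two
  arguments, of which only the values on \<open>V\<close> matter.
\<close>

definition adj_matrix :: "'v set set \<Rightarrow> 'v \<Rightarrow> 'v \<Rightarrow> complex" where
  "adj_matrix E u v = (if {u, v} \<in> E then 1 else 0)"

primrec matrix_power :: "'v set \<Rightarrow> ('v \<Rightarrow> 'v \<Rightarrow> complex) \<Rightarrow> nat \<Rightarrow> 'v \<Rightarrow> 'v \<Rightarrow> complex" where
  "matrix_power V M 0 = (\<lambda>u v. if u = v then 1 else 0)"
| "matrix_power V M (Suc k) = (\<lambda>u v. \<Sum>w\<in>V. M u w * matrix_power V M k w v)"

definition matrix_exp :: "'v set \<Rightarrow> ('v \<Rightarrow> 'v \<Rightarrow> complex) \<Rightarrow> 'v \<Rightarrow> 'v \<Rightarrow> complex" where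
  "matrix_exp V M u v = suminf (\<lambda>k. matrix_power V M k u v / fact k)"

definition transition_matrix :: "'v set \<Rightarrow> 'v set set \<Rightarrow> real \<Rightarrow> 'v \<Rightarrow> 'v \<Rightarrow> complex" where
  "transition_matrix V E t = matrix_exp V (\<lambda>u v. \<i> * of_real t * adj_matrix E u v)"

definition matrix_apply :: "'v set \<Rightarrow> ('v \<Rightarrow> 'v \<Rightarrow> complex) \<Rightarrow> ('v \<Rightarrow> complex) \<Rightarrow> 'v \<Rightarrow> complex" where
  "matrix_apply V M x u = (\<Sum>w\<in>V. M u w * x w)"

definition unit_vector :: "'v \<Rightarrow> 'v \<Rightarrow> complex" where
  "unit_vector v w = (if w = v then 1 else 0)"

definition revival ::
  "'v set \<Rightarrow> 'v set set \<Rightarrow> complex \<Rightarrow> complex \<Rightarrow> 'v \<Rightarrow> 'v \<Rightarrow> real \<Rightarrow> bool" where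
  "revival V E \<alpha> \<beta> u v t \<longleftrightarrow>
     u \<in> V \<and> v \<in> V \<and> u \<noteq> v \<and>
     (\<forall>w\<in>V. matrix_apply V (transition_matrix V E t) (unit_vector u) w
              = \<alpha> * unit_vector u w + \<beta> * unit_vector v w) \<and>
     (cmod \<alpha>)\<^sup>2 + (cmod \<beta>)\<^sup>2 = 1"

end

theory Submission
  imports Defs
begin

text \<open>
  A left eigenvector \<open>p\<close> of the adjacency matrix with eigenvalue \<open>\<lambda>\<close> is a left eigenvector of
  \<open>H(t)\<close> with eigenvalue \<open>exp (\<i>t\<lambda>)\<close>. For each \<open>z\<close> there are such \<open>p\<close> of the form
  \<open>p(g,i) = c\<^sub>i \<chi>\<^sub>z(g)\<close> with eigenvalues \<open>\<lambda>\<^sub>z\<^sup>\<plusminus>\<close>, and \<open>c\<^sub>0\<close> vanishes exactly for the one belonging to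
  \<open>\<lambda>\<^sub>z\<^sup>-\<close> when \<open>\<chi>\<^sub>z(S) = 0\<close>. Pairing them with the column of \<open>H(t)\<close> at \<open>(g,0)\<close> turns revival into
  \<open>exp (\<i>t\<lambda>) = \<alpha> + \<beta>\<chi>\<^sub>z(a)\<close> for all these \<open>\<lambda>\<close>, and back, because characters separate functions.
  As the \<open>\<lambda>\<close> are real, \<open>\<bar>\<alpha> + \<beta>\<chi>\<^sub>z(a)\<bar> = 1 = \<bar>\<alpha>\<bar>\<^sup>2 + \<bar>\<beta>\<bar>\<^sup>2\<close> for every \<open>z\<close>; comparing with \<open>z = 1\<close>
  forces every \<open>\<chi>\<^sub>z(a)\<close> to be real, so \<open>a\<^sup>2 = 1\<close>.
\<close>

section \<open>Left eigenvectors of the matrix exponential\<close>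

text \<open>The sum of all entry moduli bounds the sum of moduli in every row, so each
  multiplication by \<open>M\<close> costs one such factor. Crude, but enough for comparison with a
  real exponential series.\<close>

lemma norm_matrix_power_le:
  assumes "finite V" "u \<in> V"
  shows "norm (matrix_power V M k u v) \<le> (\<Sum>x\<in>V. \<Sum>w\<in>V. norm (M x w)) ^ k"
  using assms(2)
proof (induction k arbitrary: u)
  case 0
  then show ?case by simp
next
  case (Suc k)
  let ?B = "\<Sum>x\<in>V. \<Sum>w\<in>V. norm (M x w)"
  have B: "?B \<ge> 0" by (intro sum_nonneg) auto
  have "norm (matrix_power V M (Suc k) u v) \<le> (\<Sum>w\<in>V. norm (M u w) * ?B ^ k)"
    unfolding matrix_power.simps
    by (rule sum_norm_le) (simp add: norm_mult mult_left_mono Suc.IH)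
  also have "\<dots> = (\<Sum>w\<in>V. norm (M u w)) * ?B ^ k"
    by (simp add: sum_distrib_right)
  also have "\<dots> \<le> ?B * ?B ^ k"
    using B assms(1) Suc.prems
    by (intro mult_right_mono member_le_sum) (auto intro: sum_nonneg)
  finally show ?case by simp
qed

lemma summable_matrix_exp:
  assumes "finite V" "u \<in> V"
  shows "summable (\<lambda>k. matrix_power V M k u v / fact k)"
proof (rule summable_comparison_test')
  let ?B = "\<Sum>x\<in>V. \<Sum>w\<in>V. norm (M x w)"
  show "summable (\<lambda>k. ?B ^ k / fact k)"
    using summable_exp[of ?B] by (simp add: field_simps)
  show "norm (matrix_power V M k u v / fact k) \<le> ?B ^ k / fact k" if "k \<ge> 0" for k
    using norm_matrix_power_le[OF assms, of M k v] by (simp add: norm_divide divide_right_mono)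
qed

text \<open>\<open>matrix_power\<close> multiplies by \<open>M\<close> on the left, so unfolding one
  step puts \<open>M\<close> next to the row vector \<open>p\<close>, which turns it into the factor
  \<open>\<mu>\<close>.\<close>

lemma left_eigenvector_matrix_power:
  assumes "\<And>w. w \<in> V \<Longrightarrow> (\<Sum>x\<in>V. p x * M x w) = \<mu> * p w" and "finite V" "u \<in> V"
  shows "(\<Sum>w\<in>V. p w * matrix_power V M k w u) = \<mu> ^ k * p u"
proof (induction k)
  case 0
  then show ?case using assms(2,3) by (simp add: if_distrib cong: if_cong)
next
  case (Suc k)
  have "(\<Sum>w\<in>V. p w * matrix_power V M (Suc k) w u)
      = (\<Sum>w\<in>V. \<Sum>x\<in>V. p w * M w x * matrix_power V M k x u)"
    by (simp add: sum_distrib_left mult.assoc)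
  also have "\<dots> = (\<Sum>x\<in>V. (\<Sum>w\<in>V. p w * M w x) * matrix_power V M k x u)"
    by (subst sum.swap) (simp add: sum_distrib_right)
  also have "\<dots> = \<mu> * (\<Sum>x\<in>V. p x * matrix_power V M k x u)"
    by (simp add: assms(1) sum_distrib_left mult.assoc)
  finally show ?case by (simp add: Suc.IH)
qed

text \<open>The finite pairing with \<open>p\<close> passes through the series and leaves the terms
  of \<open>exp \<mu>\<close>, each multiplied by \<open>p u\<close>.\<close>

lemma left_eigenvector_matrix_exp:
  assumes "\<And>w. w \<in> V \<Longrightarrow> (\<Sum>x\<in>V. p x * M x w) = \<mu> * p w" and "finite V" "u \<in> V"
  shows "(\<Sum>w\<in>V. p w * matrix_exp V M w u) = exp \<mu> * p u"
proof -
  have "(\<lambda>k. \<Sum>w\<in>V. p w * (matrix_power V M k w u / fact k))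
      sums (\<Sum>w\<in>V. p w * matrix_exp V M w u)"
    unfolding matrix_exp_def
    by (intro sums_sum sums_mult summable_sums summable_matrix_exp assms)
  also have "(\<lambda>k. \<Sum>w\<in>V. p w * (matrix_power V M k w u / fact k)) = (\<lambda>k. \<mu> ^ k /\<^sub>R fact k * p u)"
    using left_eigenvector_matrix_power[OF assms]
    by (simp add: scaleR_conv_of_real field_simps flip: sum_divide_distrib)
  finally show ?thesis
    using sums_mult2[OF exp_converges[of \<mu>], of "p u"] sums_unique2 by blast
qed

lemma left_eigenvector_transition_matrix:
  assumes "\<And>w. w \<in> V \<Longrightarrow> (\<Sum>x\<in>V. p x * adj_matrix E x w) = l * p w" and "finite V" "u \<in> V"
  shows "(\<Sum>w\<in>V. p w * transition_matrix V E t w u) = exp (\<i> * of_real t * l) * p u"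
  unfolding transition_matrix_def
proof (rule left_eigenvector_matrix_exp)
  fix w assume "w \<in> V"
  then show "(\<Sum>x\<in>V. p x * (\<i> * of_real t * adj_matrix E x w)) = \<i> * of_real t * l * p w"
    using assms(1)[of w] by (simp add: mult.left_commute mult.assoc flip: sum_distrib_left)
qed (use assms in auto)

lemma matrix_apply_unit_vector:
  "finite V \<Longrightarrow> u \<in> V \<Longrightarrow> matrix_apply V M (unit_vector u) w = M w u"
  by (simp add: matrix_apply_def unit_vector_def if_distrib cong: if_cong)

section \<open>Unimodular combinations\<close>

lemma cmod_add_power2: "(cmod (a + b))\<^sup>2 = (cmod a)\<^sup>2 + (cmod b)\<^sup>2 + 2 * Re (a * cnj b)"
  unfolding cmod_power2 by (simp add: power2_eq_square algebra_simps)

text \<open>Expanding both moduli makes the cross terms vanish: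
  \<open>\<alpha> * cnj \<beta>\<close> and its product with \<open>cnj \<omega>\<close> are purely
  imaginary. The former is nonzero, so \<open>\<omega>\<close> is real, hence a sign.\<close>

lemma unimodular_combination_imp_real:
  assumes "cmod (\<alpha> + \<beta>) = 1" "cmod (\<alpha> + \<beta> * \<omega>) = 1" "(cmod \<alpha>)\<^sup>2 + (cmod \<beta>)\<^sup>2 = 1"
    and "cmod \<omega> = 1" "\<alpha> \<noteq> 0" "\<beta> \<noteq> 0"
  shows "\<omega>\<^sup>2 = 1"
proof -
  define q where "q = \<alpha> * cnj \<beta>"
  have q0: "Re q = 0"
    using cmod_add_power2[of \<alpha> \<beta>] assms by (simp add: q_def)
  have "Re (q * cnj \<omega>) = 0"
    using cmod_add_power2[of \<alpha> "\<beta> * \<omega>"] assms by (simp add: q_def norm_mult mult.assoc)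
  \<comment> \<open>As \<open>Re q = 0\<close>, the real part of \<open>q * cnj \<omega>\<close> is
    exactly this product.\<close>
  then have "Im q * Im \<omega> = 0" using q0 by simp
  moreover have "q \<noteq> 0" using assms(5,6) by (simp add: q_def)
  then have "Im q \<noteq> 0" using q0 by (simp add: complex_eq_iff)
  ultimately have "Im \<omega> = 0" by simp
  moreover from this have "(Re \<omega>)\<^sup>2 = 1"
    using assms(4) cmod_power2[of \<omega>] by simp
  ultimately show ?thesis by (simp add: complex_eq_iff power2_eq_square)
qed

section \<open>Characters\<close>

lemma root_of_unity_powi:
  "root_of_unity m powi k = exp (2 * of_real pi * \<i> * of_int k / of_nat m)"
  by (simp add: root_of_unity_def exp_power_int mult_ac)

lemma root_of_unity_nonzero [simp]: "root_of_unity m \<noteq> 0"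
  by (simp add: root_of_unity_def)

lemma norm_root_of_unity [simp]: "cmod (root_of_unity m) = 1"
  by (simp add: root_of_unity_def norm_exp_eq_Re)

lemma root_of_unity_powi_eq_1_iff:
  assumes "m > 0"
  shows "root_of_unity m powi k = 1 \<longleftrightarrow> int m dvd k"
proof -
  have "root_of_unity m powi k = 1 \<longleftrightarrow> (\<exists>n::int. 2 * pi * of_int k / of_nat m = of_int (2 * n) * pi)"
    unfolding root_of_unity_powi exp_eq_1 by simp
  also have "\<dots> \<longleftrightarrow> (\<exists>n::int. (of_int k :: real) = of_int (int m * n))"
    using assms by (intro arg_cong[of _ _ Ex] ext) (auto simp: field_simps)
  also have "\<dots> \<longleftrightarrow> int m dvd k"
    unfolding of_int_eq_iff by (auto simp: dvd_def)
  finally show ?thesis .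
qed

text \<open>Coordinates of products are reduced modulo \<open>ns s\<close>; this removes the
  reduction from exponents.\<close>

lemma root_of_unity_powi_cong:
  assumes "m > 0" "k mod int m = l mod int m"
  shows "root_of_unity m powi k = root_of_unity m powi l"
proof -
  have "root_of_unity m powi (k - l) = 1"
    using assms by (simp add: root_of_unity_powi_eq_1_iff mod_eq_dvd_iff)
  then show ?thesis by (simp add: power_int_diff)
qed

text \<open>Symmetry carries multiplicativity from the second argument over to the label
  \<open>z\<close>.\<close>

lemma chi_commute: "chi r ns \<phi> z g = chi r ns \<phi> g z"
  by (simp add: chi_def mult.commute)

lemma norm_chi [simp]: "cmod (chi r ns \<phi> z g) = 1"
  by (simp add: chi_def norm_power_int flip: prod_norm)

lemma chi_nonzero [simp]: "chi r ns \<phi> z g \<noteq> 0"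
  using norm_chi[of r ns \<phi> z g] by fastforce

section \<open>Characters of a group with coordinates\<close>

locale coordinatized_group = comm_group G for G :: "('a, 'm) monoid_scheme" (structure) +
  fixes r :: nat and ns :: "nat \<Rightarrow> nat" and \<phi> :: "'a \<Rightarrow> nat \<Rightarrow> int"
  assumes finite_carrier: "finite (carrier G)"
    and ns_pos: "s < r \<Longrightarrow> ns s > 0"
    and iso: "\<phi> \<in> iso G (product_group {..<r} (\<lambda>s. integer_mod_group (ns s)))"
begin

abbreviation "\<psi> \<equiv> chi r ns \<phi>"
abbreviation "\<Psi> \<equiv> chi_sum r ns \<phi>"

lemma coord_mult:
  assumes "x \<in> carrier G" "y \<in> carrier G" "s < r"
  shows "\<phi> (x \<otimes> y) s = (\<phi> x s + \<phi> y s) mod int (ns s)"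
proof -
  have "\<phi> (x \<otimes> y) = \<phi> x \<otimes>\<^bsub>product_group {..<r} (\<lambda>s. integer_mod_group (ns s))\<^esub> \<phi> y"
    using iso assms by (simp add: iso_def hom_def)
  then show ?thesis using assms(3) by simp
qed

lemma coord_carrier:
  assumes "x \<in> carrier G"
  shows "\<phi> x \<in> (\<Pi>\<^sub>E s\<in>{..<r}. {0..<int (ns s)})"
proof -
  have "\<phi> x \<in> carrier (product_group {..<r} (\<lambda>s. integer_mod_group (ns s)))"
    using iso assms by (auto simp: iso_def hom_def)
  then show ?thesis using ns_pos
    by (auto simp: PiE_iff carrier_integer_mod_group split: if_splits)
qed

lemma coord_eq_0:
  assumes "x \<in> carrier G" "s < r" "int (ns s) dvd \<phi> x s"
  shows "\<phi> x s = 0"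
proof (rule ccontr)
  assume "\<phi> x s \<noteq> 0"
  moreover have *: "0 \<le> \<phi> x s" "\<phi> x s < int (ns s)"
    using PiE_mem[OF coord_carrier[OF assms(1)], of s] assms(2) by simp_all
  ultimately have "0 < \<phi> x s" by linarith
  then show False using zdvd_not_zless *(2) assms(3) by blast
qed

lemma ex_coord:
  assumes "f \<in> (\<Pi>\<^sub>E s\<in>{..<r}. {0..<int (ns s)})"
  shows "\<exists>x\<in>carrier G. \<phi> x = f"
proof -
  have "f \<in> carrier (product_group {..<r} (\<lambda>s. integer_mod_group (ns s)))"
    using assms ns_pos by (auto simp: PiE_iff carrier_integer_mod_group)
  then have "f \<in> \<phi> ` carrier G" using iso by (simp add: iso_def bij_betw_def)
  then show ?thesis by blast
qed

lemma chi_mult: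
  assumes "x \<in> carrier G" "y \<in> carrier G"
  shows "\<psi> z (x \<otimes> y) = \<psi> z x * \<psi> z y"
proof -
  have "root_of_unity (ns s) powi (\<phi> z s * \<phi> (x \<otimes> y) s)
      = root_of_unity (ns s) powi (\<phi> z s * \<phi> x s) * root_of_unity (ns s) powi (\<phi> z s * \<phi> y s)"
    if "s < r" for s
  proof -
    have "root_of_unity (ns s) powi (\<phi> z s * \<phi> (x \<otimes> y) s)
        = root_of_unity (ns s) powi (\<phi> z s * \<phi> x s + \<phi> z s * \<phi> y s)"
      using that ns_pos assms
      by (intro root_of_unity_powi_cong) (auto simp: coord_mult mod_mult_right_eq simp flip: distrib_left)
    then show ?thesis by (simp add: power_int_add)
  qed
  then show ?thesis by (simp add: chi_def prod.distrib)
qed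

lemma chi_one [simp]: "\<psi> z \<one> = 1"
  using chi_mult[of \<one> \<one> z] by simp

lemma chi_inv:
  assumes "x \<in> carrier G"
  shows "\<psi> z (inv x) = cnj (\<psi> z x)"
proof -
  have "\<psi> z x * \<psi> z (inv x) = 1"
    using assms chi_mult[of x "inv x" z] by simp
  moreover have "\<psi> z x * cnj (\<psi> z x) = 1"
    by (simp flip: complex_norm_square)
  ultimately show ?thesis
    by (metis chi_nonzero mult_left_cancel)
qed

text \<open>The character whose label is the unit vector in direction \<open>s\<close> reads off the
  coordinate \<open>\<phi> x s\<close> modulo \<open>ns s\<close>.\<close>

lemma chi_separates:
  assumes "x \<in> carrier G" and "\<And>z. z \<in> carrier G \<Longrightarrow> \<psi> z x = 1"
  shows "x = \<one>"
proof -
  have "\<phi> x s = 0" if s: "s < r" for s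
  proof -
    \<comment> \<open>The entry is \<open>1 mod int (ns s)\<close> rather than \<open>1\<close>
      because for \<open>ns s = 1\<close> the only admissible residue is \<open>0\<close>.\<close>
    let ?f = "\<lambda>i\<in>{..<r}. if i = s then 1 mod int (ns s) else 0"
    have "?f \<in> (\<Pi>\<^sub>E i\<in>{..<r}. {0..<int (ns i)})"
      using ns_pos by auto
    then obtain z where z: "z \<in> carrier G" "\<phi> z = ?f"
      using ex_coord by blast
    have "\<psi> z x = (\<Prod>i<r. if i = s then root_of_unity (ns s) powi (1 mod int (ns s) * \<phi> x s) else 1)"
      unfolding chi_def z by (intro prod.cong) auto
    also have "\<dots> = root_of_unity (ns s) powi (1 mod int (ns s) * \<phi> x s)"
      using s by simp
    also have "\<dots> = root_of_unity (ns s) powi (\<phi> x s)"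
      using ns_pos[OF s] by (intro root_of_unity_powi_cong) (auto simp: mod_mult_left_eq)
    finally have "int (ns s) dvd \<phi> x s"
      using assms(2)[OF z(1)] ns_pos[OF s] by (simp add: root_of_unity_powi_eq_1_iff)
    then show ?thesis using coord_eq_0 assms(1) s by blast
  qed
  moreover have "\<phi> \<one> s = 0" if "s < r" for s
  proof -
    \<comment> \<open>The identity is idempotent, so its coordinate is congruent to its own
      double.\<close>
    have "\<phi> \<one> s mod int (ns s) = (\<phi> \<one> s + \<phi> \<one> s) mod int (ns s)"
      using coord_mult[of \<one> \<one> s] that by (metis l_one mod_mod_trivial one_closed)
    then have "int (ns s) dvd \<phi> \<one> s"
      using mod_eq_dvd_iff[of "\<phi> \<one> s + \<phi> \<one> s" "int (ns s)" "\<phi> \<one> s"] by simp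
    then show ?thesis using coord_eq_0 that by blast
  qed
  ultimately have "\<phi> x = \<phi> \<one>"
    using coord_carrier[OF assms(1)] coord_carrier[OF one_closed]
    by (intro extensionalityI[of _ "{..<r}"]) (auto simp: PiE_iff)
  then show ?thesis
    using iso assms(1) by (auto simp: iso_def bij_betw_def dest: inj_onD)
qed

section \<open>Orthogonality and injectivity of the Fourier transform\<close>

lemma sum_reindex_mult:
  fixes f :: "'a \<Rightarrow> complex"
  assumes "x \<in> carrier G"
  shows "(\<Sum>y\<in>carrier G. f y) = (\<Sum>y\<in>carrier G. f (y \<otimes> x))"
  by (rule sum.reindex_bij_witness[of _ "\<lambda>y. y \<otimes> x" "\<lambda>y. y \<otimes> inv x"])
     (use assms in \<open>auto simp: m_assoc\<close>)

text \<open>For \<open>x\<close> other than the identity some \<open>\<psi> w x\<close> differs from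
  1. Translating the summation variable by \<open>w\<close> multiplies the sum by
  \<open>\<psi> w x\<close>, so the sum is zero.\<close>

lemma chi_orthogonality:
  assumes "x \<in> carrier G"
  shows "(\<Sum>z\<in>carrier G. \<psi> z x) = (if x = \<one> then of_nat (order G) else 0)"
proof (cases "x = \<one>")
  case True
  then show ?thesis by (simp add: order_def)
next
  case False
  then obtain w where w: "w \<in> carrier G" "\<psi> w x \<noteq> 1"
    using chi_separates assms by blast
  have "(\<Sum>z\<in>carrier G. \<psi> z x) = (\<Sum>z\<in>carrier G. \<psi> (z \<otimes> w) x)"
    by (rule sum_reindex_mult) fact
  also have "\<dots> = (\<Sum>z\<in>carrier G. \<psi> z x) * \<psi> w x"
    using w by (simp add: chi_commute[of _ _ _ _ x] chi_mult sum_distrib_right)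
  finally show ?thesis using w False by simp
qed

text \<open>Fourier inversion: weighting the transform with \<open>\<psi> z (inv y)\<close> and
  summing over \<open>z\<close> isolates the term \<open>x = y\<close>, with factor the group
  order.\<close>

lemma fourier_eq_0_imp:
  fixes f :: "'a \<Rightarrow> complex"
  assumes "\<And>z. z \<in> carrier G \<Longrightarrow> (\<Sum>x\<in>carrier G. \<psi> z x * f x) = 0" and y: "y \<in> carrier G"
  shows "f y = 0"
proof -
  have eq: "x \<otimes> inv y = \<one> \<longleftrightarrow> x = y" if "x \<in> carrier G" for x
    using that y by (metis inv_closed inv_equality inv_inv r_inv)
  have "0 = (\<Sum>z\<in>carrier G. (\<Sum>x\<in>carrier G. \<psi> z x * f x) * \<psi> z (inv y))"
    using assms by simp
  also have "\<dots> = (\<Sum>x\<in>carrier G. \<Sum>z\<in>carrier G. \<psi> z (x \<otimes> inv y) * f x)"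
    using y by (subst sum.swap) (simp add: chi_mult sum_distrib_left sum_distrib_right mult_ac)
  also have "\<dots> = (\<Sum>x\<in>carrier G. if x = y then of_nat (order G) * f x else 0)"
    using y eq
    by (intro sum.cong) (auto simp: chi_orthogonality simp flip: sum_distrib_right)
  also have "\<dots> = of_nat (order G) * f y"
    using y finite_carrier by simp
  finally show ?thesis
    using order_gt_0_iff_finite finite_carrier by simp
qed

text \<open>The indicator is column \<open>x\<close> of the Cayley matrix of \<open>T\<close>; thus
  the row vector \<open>\<psi> z\<close> is a left eigenvector of that matrix with eigenvalue
  \<open>\<Psi> z T\<close>.\<close>

lemma sum_chi_translate:
  assumes "x \<in> carrier G" "T \<subseteq> carrier G"
  shows "(\<Sum>y\<in>carrier G. \<psi> z y * (if y \<otimes> inv x \<in> T then 1 else 0)) = \<psi> z x * \<Psi> z T"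
proof -
  have "(\<Sum>y\<in>carrier G. \<psi> z y * (if y \<otimes> inv x \<in> T then 1 else 0))
      = (\<Sum>y\<in>carrier G. \<psi> z (y \<otimes> x) * (if y \<in> T then 1 else 0))"
    using assms(1) by (subst sum_reindex_mult[OF assms(1)]) (simp add: m_assoc)
  also have "\<dots> = (\<Sum>y\<in>carrier G. if y \<in> T then \<psi> z x * \<psi> z y else 0)"
    using assms by (intro sum.cong) (auto simp: chi_mult)
  also have "\<dots> = (\<Sum>y\<in>T. \<psi> z x * \<psi> z y)"
    using finite_carrier assms by (simp add: Int_absorb1 flip: sum.inter_restrict)
  finally show ?thesis by (simp add: chi_sum_def sum_distrib_left)
qed

text \<open>For \<open>R\<close> and \<open>L\<close> this yields reality of the character sums, for
  \<open>S\<close> the conjugate entry in the other off-diagonal block.\<close>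

lemma chi_sum_set_inv:
  assumes "T \<subseteq> carrier G"
  shows "\<Psi> z (set_inv T) = cnj (\<Psi> z T)"
proof -
  have "set_inv T = (\<lambda>x. inv x) ` T" by (auto simp: SET_INV_def)
  moreover have "inj_on (\<lambda>x. inv x) T" using assms inv_inj inj_on_subset by blast
  ultimately have "\<Psi> z (set_inv T) = (\<Sum>y\<in>T. \<psi> z (inv y))"
    by (simp add: chi_sum_def sum.reindex)
  also have "\<dots> = cnj (\<Psi> z T)"
    using assms by (auto simp: chi_sum_def chi_inv intro!: sum.cong)
  finally show ?thesis .
qed

lemma mem_set_inv_iff:
  assumes "T \<subseteq> carrier G" "x \<in> carrier G" "y \<in> carrier G"
  shows "y \<otimes> inv x \<in> set_inv T \<longleftrightarrow> x \<otimes> inv y \<in> T"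
proof -
  have *: "inv (x \<otimes> inv y) = y \<otimes> inv x" "inv (y \<otimes> inv x) = x \<otimes> inv y"
    using assms by (simp_all add: inv_mult_group)
  show ?thesis
  proof
    assume "y \<otimes> inv x \<in> set_inv T"
    then obtain w where "w \<in> T" "y \<otimes> inv x = inv w" by (auto simp: SET_INV_def)
    then show "x \<otimes> inv y \<in> T" using * assms by (metis inv_inv subsetD)
  next
    assume "x \<otimes> inv y \<in> T"
    then show "y \<otimes> inv x \<in> set_inv T" unfolding SET_INV_def using * by force
  qed
qed

end

lemma (in group) ord_eq_2_iff:
  assumes "a \<in> carrier G"
  shows "ord a = 2 \<longleftrightarrow> a \<noteq> \<one> \<and> a \<otimes> a = \<one>"
proof -
  have sq: "a \<otimes> a = a [^] (2::nat)"
    using assms by (simp add: numeral_2_eq_2)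
  show ?thesis
  proof
    assume "ord a = 2"
    then show "a \<noteq> \<one> \<and> a \<otimes> a = \<one>"
      using assms pow_ord_eq_1[of a] by (auto simp: sq)
  next
    assume a: "a \<noteq> \<one> \<and> a \<otimes> a = \<one>"
    then have "ord a dvd 2" using assms pow_eq_id[of a 2] by (simp add: sq)
    moreover have "ord a \<noteq> 1" using a assms ord_eq_1 by blast
    ultimately show "ord a = 2" using two_is_prime_nat by (metis prime_nat_iff)
  qed
qed

section \<open>Eigenvectors of semi-Cayley graphs\<close>

locale semi_cayley = coordinatized_group G r ns \<phi>
  for G :: "('a, 'm) monoid_scheme" (structure) and r ns \<phi> +
  fixes R L S :: "'a set"
  assumes R: "R \<subseteq> carrier G" "set_inv R = R"
    and L: "L \<subseteq> carrier G" "set_inv L = L"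
    and S: "S \<subseteq> carrier G"
begin

abbreviation "V \<equiv> sc_verts G"
abbreviation "E \<equiv> sc_edges G R L S"
abbreviation "lam_plus \<equiv> sc_eig_plus r ns \<phi> R L S"
abbreviation "lam_minus \<equiv> sc_eig_minus r ns \<phi> R L S"
abbreviation "\<rho> \<equiv> sc_root r ns \<phi> R L S"

lemma finite_verts: "finite V"
  using finite_carrier by (simp add: sc_verts_def)

lemma sum_verts:
  fixes f :: "'a \<times> nat \<Rightarrow> complex"
  shows "(\<Sum>w\<in>V. f w) = (\<Sum>x\<in>carrier G. f (x, 0)) + (\<Sum>x\<in>carrier G. f (x, 1))"
  unfolding sc_verts_def by (simp add: sum.cartesian_product' sum.distrib)

text \<open>Block form of the adjacency matrix: \<open>R\<close> and \<open>L\<close> on the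
  diagonal, \<open>S\<close> below and \<open>set_inv S\<close> above. Edges are unordered, so an
  entry must also account for the reversed pair, whose quotient is the inverse.\<close>

lemma adj_matrix_layers:
  assumes "x \<in> carrier G" "y \<in> carrier G"
  shows "adj_matrix E (y, 0) (x, 0) = (if y \<otimes> inv x \<in> R then 1 else 0)"
    and "adj_matrix E (y, 1) (x, 1) = (if y \<otimes> inv x \<in> L then 1 else 0)"
    and "adj_matrix E (y, 1) (x, 0) = (if y \<otimes> inv x \<in> S then 1 else 0)"
    and "adj_matrix E (y, 0) (x, 1) = (if y \<otimes> inv x \<in> set_inv S then 1 else 0)"
  using assms mem_set_inv_iff[OF R(1), of x y] mem_set_inv_iff[OF L(1), of x y]
    mem_set_inv_iff[OF S, of x y] R(2) L(2)
  by (auto simp: adj_matrix_def sc_edges_def doubleton_eq_iff)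

definition layered :: "'a \<Rightarrow> complex \<Rightarrow> complex \<Rightarrow> 'a \<times> nat \<Rightarrow> complex" where
  "layered z c\<^sub>0 c\<^sub>1 w = (if snd w = 0 then c\<^sub>0 else c\<^sub>1) * \<psi> z (fst w)"

text \<open>Each block acts on \<open>\<psi> z\<close> by a scalar. What remains is that the row
  \<open>(c\<^sub>0, c\<^sub>1)\<close> be a left eigenvector of the two-by-two matrix with rows
  \<open>(\<Psi> z R, cnj (\<Psi> z S))\<close> and \<open>(\<Psi> z S, \<Psi> z L)\<close>.\<close>

lemma left_eigenvector_layered:
  assumes "c\<^sub>0 * \<Psi> z R + c\<^sub>1 * \<Psi> z S = l * c\<^sub>0" "c\<^sub>0 * cnj (\<Psi> z S) + c\<^sub>1 * \<Psi> z L = l * c\<^sub>1"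
    and "w \<in> V"
  shows "(\<Sum>v\<in>V. layered z c\<^sub>0 c\<^sub>1 v * adj_matrix E v w) = l * layered z c\<^sub>0 c\<^sub>1 w"
proof -
  have iS: "set_inv S \<subseteq> carrier G" using S by (auto simp: SET_INV_def)
  obtain x where x: "x \<in> carrier G" "w = (x, 0) \<or> w = (x, 1)"
    using assms(3) by (auto simp: sc_verts_def)
  have layer: "(\<Sum>y\<in>carrier G. c * \<psi> z y * (if y \<otimes> inv x \<in> T then 1 else 0)) = c * (\<psi> z x * \<Psi> z T)"
    if "T \<subseteq> carrier G" for c T
    using sum_chi_translate[OF x(1) that, of z] by (simp only: mult.assoc flip: sum_distrib_left)
  from x(2) show ?thesis
  proof
    assume w: "w = (x, 0)"
    have "(\<Sum>v\<in>V. layered z c\<^sub>0 c\<^sub>1 v * adj_matrix E v w) = c\<^sub>0 * (\<psi> z x * \<Psi> z R) + c\<^sub>1 * (\<psi> z x * \<Psi> z S)"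
      unfolding sum_verts w
      using layer[OF R(1), of c\<^sub>0] layer[OF S, of c\<^sub>1]
      by (simp add: layered_def adj_matrix_layers x(1) del: One_nat_def cong: sum.cong)
    also have "\<dots> = \<psi> z x * (c\<^sub>0 * \<Psi> z R + c\<^sub>1 * \<Psi> z S)" by (simp add: algebra_simps)
    finally show ?thesis by (simp add: assms(1) w layered_def)
  next
    assume w: "w = (x, 1)"
    have "(\<Sum>v\<in>V. layered z c\<^sub>0 c\<^sub>1 v * adj_matrix E v w)
        = c\<^sub>0 * (\<psi> z x * cnj (\<Psi> z S)) + c\<^sub>1 * (\<psi> z x * \<Psi> z L)"
      unfolding sum_verts w
      using layer[OF iS, of c\<^sub>0] layer[OF L(1), of c\<^sub>1]
      by (simp add: layered_def adj_matrix_layers x(1) chi_sum_set_inv[OF S] del: One_nat_def cong: sum.cong)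
    also have "\<dots> = \<psi> z x * (c\<^sub>0 * cnj (\<Psi> z S) + c\<^sub>1 * \<Psi> z L)" by (simp add: algebra_simps)
    finally show ?thesis by (simp add: assms(2) w layered_def)
  qed
qed

lemma chi_sum_R_real: "\<Psi> z R \<in> \<real>" and chi_sum_L_real: "\<Psi> z L \<in> \<real>"
  using chi_sum_set_inv[OF R(1), of z] chi_sum_set_inv[OF L(1), of z] R(2) L(2)
  by (simp_all add: Reals_cnj_iff)

text \<open>Displays the radicand as a nonnegative real, so that its \<open>csqrt\<close> is an
  ordinary real root.\<close>

lemma radicand_eq:
  "sc_radicand r ns \<phi> R L S z
     = of_real ((Re (\<Psi> z R) - Re (\<Psi> z L))\<^sup>2 + 4 * (cmod (\<Psi> z S))\<^sup>2)"
  using chi_sum_R_real[of z] chi_sum_L_real[of z]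
  by (simp add: sc_radicand_def)

text \<open>Both branches of \<open>sc_root\<close> have the same square, so the characteristic
  equation needs no case split.\<close>

lemma root_power2: "(\<rho> z)\<^sup>2 = (\<Psi> z R - \<Psi> z L)\<^sup>2 + 4 * (\<Psi> z S * cnj (\<Psi> z S))"
  by (simp add: sc_root_def sc_radicand_def complex_norm_square del: of_real_power)

text \<open>\<open>\<rho> z\<close> is the gap between the two eigenvalues, which are therefore
  distinct.\<close>

lemma root_nonzero:
  assumes "\<Psi> z S \<noteq> 0"
  shows "\<rho> z \<noteq> 0"
proof -
  have "(Re (\<Psi> z R) - Re (\<Psi> z L))\<^sup>2 + 4 * (cmod (\<Psi> z S))\<^sup>2 > 0"
    using assms by (intro add_nonneg_pos) auto
  then show ?thesis
    using assms by (simp add: sc_root_def radicand_eq del: of_real_add of_real_mult of_real_power)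
qed

lemma root_real: "\<rho> z \<in> \<real>"
proof (cases "\<Psi> z S = 0")
  case True
  then show ?thesis by (simp add: sc_root_def chi_sum_R_real chi_sum_L_real)
next
  case False
  have "csqrt (sc_radicand r ns \<phi> R L S z)
      = of_real (sqrt ((Re (\<Psi> z R) - Re (\<Psi> z L))\<^sup>2 + 4 * (cmod (\<Psi> z S))\<^sup>2))"
    unfolding radicand_eq by (rule csqrt_of_real) simp
  then show ?thesis using False by (simp add: sc_root_def)
qed

lemma norm_exp_eig_plus: "cmod (exp (\<i> * of_real t * lam_plus z)) = 1"
proof -
  have "lam_plus z \<in> \<real>"
    unfolding sc_eig_plus_def
    by (intro Reals_mult Reals_add chi_sum_R_real chi_sum_L_real root_real) simp
  then show ?thesis by (simp add: norm_exp_eq_Re complex_is_Real_iff)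
qed

text \<open>The coefficients solve the first equation of the two-by-two system identically; the
  second becomes the characteristic equation. For \<open>\<Psi> z S = 0\<close> and
  \<open>l = lam_plus z\<close> the vector is zero, so that case is handled with other vectors
  later.\<close>

lemma left_eigenvector_eig:
  assumes "l = lam_plus z \<or> l = lam_minus z" "w \<in> V"
  shows "(\<Sum>v\<in>V. layered z (\<Psi> z S) (l - \<Psi> z R) v * adj_matrix E v w)
      = l * layered z (\<Psi> z S) (l - \<Psi> z R) w"
proof (rule left_eigenvector_layered)
  have "2 * l - (\<Psi> z R + \<Psi> z L) = \<rho> z \<or> 2 * l - (\<Psi> z R + \<Psi> z L) = - \<rho> z"
    using assms(1) by (auto simp: sc_eig_plus_def sc_eig_minus_def field_simps)
  then have "(2 * l - (\<Psi> z R + \<Psi> z L))\<^sup>2 = (\<rho> z)\<^sup>2" by auto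
  \<comment> \<open>Undoing the completed square gives four times the characteristic
    equation.\<close>
  then have "4 * (\<Psi> z S * cnj (\<Psi> z S) + (l - \<Psi> z R) * \<Psi> z L - l * (l - \<Psi> z R)) = 0"
    unfolding root_power2 by (simp add: power2_eq_square algebra_simps)
  then show "\<Psi> z S * cnj (\<Psi> z S) + (l - \<Psi> z R) * \<Psi> z L = l * (l - \<Psi> z R)"
    by (simp only: mult_eq_0_iff right_minus_eq) simp
qed (use assms(2) in \<open>simp_all add: algebra_simps\<close>)

lemma eig_zero:
  assumes "\<Psi> z S = 0"
  shows "lam_plus z = \<Psi> z R" "lam_minus z = \<Psi> z L"
  using assms by (simp_all add: sc_eig_plus_def sc_eig_minus_def sc_root_def)

section \<open>Spectral form of revival\<close>

text \<open>The defect \<open>d\<close> is paired with layered eigenvectors in two ways: through the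
  eigenvalues of \<open>H(t)\<close> (\<open>pair\<close>) and through its Fourier transforms
  \<open>F\<close> on the two layers (\<open>sum_layered\<close>). Revival means
  \<open>F = 0\<close>.\<close>

lemma revival_iff_eigenvalues:
  assumes g: "g \<in> carrier G" and h: "h \<in> carrier G"
  shows "(\<forall>w\<in>V. matrix_apply V (transition_matrix V E t) (unit_vector (g, 0)) w
             = \<alpha> * unit_vector (g, 0) w + \<beta> * unit_vector (h, 0) w) \<longleftrightarrow>
         (\<forall>z\<in>carrier G.
            exp (\<i> * of_real t * lam_plus z) = \<alpha> + \<beta> * \<psi> z (inv g \<otimes> h) \<and>
            (\<Psi> z S \<noteq> 0 \<longrightarrow> exp (\<i> * of_real t * lam_minus z) = \<alpha> + \<beta> * \<psi> z (inv g \<otimes> h)))"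
    (is "?rev \<longleftrightarrow> ?eig")
proof -
  define d where "d w = transition_matrix V E t w (g, 0)
      - (\<alpha> * unit_vector (g, 0) w + \<beta> * unit_vector (h, 0) w)" for w
  have gV: "(g, 0) \<in> V" and hV: "(h, 0) \<in> V"
    using g h by (auto simp: sc_verts_def)
  have rev: "?rev \<longleftrightarrow> (\<forall>w\<in>V. d w = 0)"
    by (simp add: matrix_apply_unit_vector finite_verts gV d_def)
  have sum_unit: "(\<Sum>w\<in>V. p w * unit_vector u w) = p u" if "u \<in> V" for p u
    using that finite_verts by (simp add: unit_vector_def if_distrib cong: if_cong)
  have chi_h: "\<psi> z h = \<psi> z g * \<psi> z (inv g \<otimes> h)" for z
    using g h by (simp add: m_assoc[symmetric] flip: chi_mult)
  have pair: "(\<Sum>w\<in>V. layered z c\<^sub>0 c\<^sub>1 w * d w)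
      = c\<^sub>0 * \<psi> z g * (exp (\<i> * of_real t * l) - (\<alpha> + \<beta> * \<psi> z (inv g \<otimes> h)))"
    if "\<And>w. w \<in> V \<Longrightarrow> (\<Sum>v\<in>V. layered z c\<^sub>0 c\<^sub>1 v * adj_matrix E v w) = l * layered z c\<^sub>0 c\<^sub>1 w"
    for z c\<^sub>0 c\<^sub>1 l
  proof -
    let ?p = "layered z c\<^sub>0 c\<^sub>1"
    have "(\<Sum>w\<in>V. ?p w * d w) = (\<Sum>w\<in>V. ?p w * transition_matrix V E t w (g, 0))
        - (\<alpha> * (\<Sum>w\<in>V. ?p w * unit_vector (g, 0) w) + \<beta> * (\<Sum>w\<in>V. ?p w * unit_vector (h, 0) w))"
      unfolding d_def by (simp add: algebra_simps sum.distrib sum_subtractf sum_distrib_left)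
    also have "\<dots> = exp (\<i> * of_real t * l) * ?p (g, 0) - (\<alpha> * ?p (g, 0) + \<beta> * ?p (h, 0))"
      using left_eigenvector_transition_matrix[OF that finite_verts gV, of t]
      by (simp add: sum_unit gV hV)
    finally show ?thesis by (simp add: layered_def chi_h algebra_simps)
  qed
  define F where "F z i = (\<Sum>x\<in>carrier G. \<psi> z x * d (x, i))" for z and i :: nat
  have sum_layered: "(\<Sum>w\<in>V. layered z c\<^sub>0 c\<^sub>1 w * d w) = c\<^sub>0 * F z 0 + c\<^sub>1 * F z 1" for z c\<^sub>0 c\<^sub>1
    unfolding sum_verts F_def by (simp add: layered_def sum_distrib_left mult.assoc)
  have "(\<forall>w\<in>V. d w = 0) \<longleftrightarrow> (\<forall>z\<in>carrier G. F z 0 = 0 \<and> F z 1 = 0)"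
  proof
    assume "\<forall>w\<in>V. d w = 0"
    then show "\<forall>z\<in>carrier G. F z 0 = 0 \<and> F z 1 = 0"
      by (auto simp: F_def sc_verts_def)
  next
    assume "\<forall>z\<in>carrier G. F z 0 = 0 \<and> F z 1 = 0"
    then have "d (x, i) = 0" if "x \<in> carrier G" "i = 0 \<or> i = 1" for x i
      using that fourier_eq_0_imp[of "\<lambda>x. d (x, i)" x] by (auto simp: F_def)
    then show "\<forall>w\<in>V. d w = 0" by (auto simp: sc_verts_def)
  qed
  also have "\<dots> \<longleftrightarrow> ?eig"
  proof (intro ball_cong refl)
    fix z
    let ?c = "\<alpha> + \<beta> * \<psi> z (inv g \<otimes> h)"
    let ?e = "\<lambda>l. exp (\<i> * of_real t * l)"
    show "(F z 0 = 0 \<and> F z 1 = 0) \<longleftrightarrow>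
        (?e (lam_plus z) = ?c \<and> (\<Psi> z S \<noteq> 0 \<longrightarrow> ?e (lam_minus z) = ?c))"
    proof (cases "\<Psi> z S = 0")
      case True
      have "F z 0 = \<psi> z g * (?e (\<Psi> z R) - ?c)"
        using pair[of z 1 0 "\<Psi> z R", OF left_eigenvector_layered] True
        by (simp add: sum_layered)
      \<comment> \<open>The eigenvector supported on layer 1 pairs to zero with both the initial and
        the target vector, so \<open>lam_minus z\<close> imposes no condition here.\<close>
      moreover have "F z 1 = 0"
        using pair[of z 0 1 "\<Psi> z L", OF left_eigenvector_layered] True
        by (simp add: sum_layered)
      ultimately show ?thesis using True eig_zero[of z] by simp
    next
      case False
      have *: "\<Psi> z S * F z 0 + (l - \<Psi> z R) * F z 1 = \<Psi> z S * \<psi> z g * (?e l - ?c)"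
        if "l = lam_plus z \<or> l = lam_minus z" for l
        using pair[OF left_eigenvector_eig[OF that]] by (simp add: sum_layered)
      have "lam_plus z - lam_minus z = \<rho> z"
        by (simp add: sc_eig_plus_def sc_eig_minus_def field_simps)
      \<comment> \<open>Distinct eigenvalues make the two equations in \<open>F z 0\<close> and
        \<open>F z 1\<close> independent.\<close>
      then have ne: "lam_plus z - lam_minus z \<noteq> 0" using root_nonzero[OF False] by simp
      show ?thesis
      proof
        assume "F z 0 = 0 \<and> F z 1 = 0"
        then show "?e (lam_plus z) = ?c \<and> (\<Psi> z S \<noteq> 0 \<longrightarrow> ?e (lam_minus z) = ?c)"
          using *[of "lam_plus z"] *[of "lam_minus z"] False by simp
      next
        assume "?e (lam_plus z) = ?c \<and> (\<Psi> z S \<noteq> 0 \<longrightarrow> ?e (lam_minus z) = ?c)"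
        then have eqs: "\<Psi> z S * F z 0 + (lam_plus z - \<Psi> z R) * F z 1 = 0"
            "\<Psi> z S * F z 0 + (lam_minus z - \<Psi> z R) * F z 1 = 0"
          using *[of "lam_plus z"] *[of "lam_minus z"] False by simp_all
        have "(lam_plus z - lam_minus z) * F z 1
            = (\<Psi> z S * F z 0 + (lam_plus z - \<Psi> z R) * F z 1)
              - (\<Psi> z S * F z 0 + (lam_minus z - \<Psi> z R) * F z 1)"
          by (simp add: algebra_simps)
        also have "\<dots> = 0" unfolding eqs by simp
        finally have "F z 1 = 0" using ne by simp
        then show "F z 0 = 0 \<and> F z 1 = 0" using eqs(1) False by simp
      qed
    qed
  qed
  finally show ?thesis using rev by simp
qed

end

section \<open>Order of \<open>a\<close> and splitting by the sign of the characters at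
  \<open>a\<close>\<close>

theorem theorem3p5:
  fixes G :: "('a, 'm) monoid_scheme"
    and r :: nat and ns :: "nat \<Rightarrow> nat" and \<phi> :: "'a \<Rightarrow> nat \<Rightarrow> int"
    and R L S :: "'a set" and g h :: 'a
    and \<alpha> \<beta> :: complex and t :: real
  assumes "comm_group G" and "finite (carrier G)"
    and "\<And>s. s < r \<Longrightarrow> ns s > 0"
    and "\<phi> \<in> iso G (product_group {..<r} (\<lambda>s. integer_mod_group (ns s)))"
    and "R \<subseteq> carrier G" and "L \<subseteq> carrier G" and "S \<subseteq> carrier G"
    and "set_inv\<^bsub>G\<^esub> R = R" and "set_inv\<^bsub>G\<^esub> L = L" and "\<one>\<^bsub>G\<^esub> \<notin> R \<union> L"
    and "\<alpha> \<noteq> 0" and "\<beta> \<noteq> 0"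
    and "g \<in> carrier G" and "h \<in> carrier G"
  shows "let X\<^sub>S = {z \<in> carrier G. chi_sum r ns \<phi> z S = 0};
             a = inv\<^bsub>G\<^esub> g \<otimes>\<^bsub>G\<^esub> h;
             G0 = {z \<in> carrier G. chi r ns \<phi> z a = 1};
             G1 = {z \<in> carrier G. chi r ns \<phi> z a = - 1}
         in revival (sc_verts G) (sc_edges G R L S) \<alpha> \<beta> (g, 0) (h, 0) t \<longleftrightarrow>
              (group.ord G a = 2 \<and> even (order G)) \<and>
              (\<forall>z\<in>G0. exp (\<i> * of_real t * sc_eig_plus r ns \<phi> R L S z) = \<alpha> + \<beta>) \<and>
              (\<forall>z\<in>G1. exp (\<i> * of_real t * sc_eig_plus r ns \<phi> R L S z) = \<alpha> - \<beta>) \<and>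
              (\<forall>z\<in>G0 - X\<^sub>S. exp (\<i> * of_real t * sc_eig_minus r ns \<phi> R L S z) = \<alpha> + \<beta>) \<and>
              (\<forall>z\<in>G1 - X\<^sub>S. exp (\<i> * of_real t * sc_eig_minus r ns \<phi> R L S z) = \<alpha> - \<beta>)"
proof -
  interpret comm_group G by fact
  interpret semi_cayley G r ns \<phi> R L S
    by unfold_locales (use assms in auto)
  define a where "a = inv\<^bsub>G\<^esub> g \<otimes>\<^bsub>G\<^esub> h"
  have aG: "a \<in> carrier G" using assms by (simp add: a_def)
  let ?spec = "\<lambda>c. \<forall>z\<in>carrier G. exp (\<i> * of_real t * lam_plus z) = c z \<and>
      (\<Psi> z S \<noteq> 0 \<longrightarrow> exp (\<i> * of_real t * lam_minus z) = c z)"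
  have a_one: "a = \<one>\<^bsub>G\<^esub> \<longleftrightarrow> g = h"
    using assms by (metis a_def inv_closed inv_equality inv_inv l_inv)
  have sq: "\<psi> z (a \<otimes>\<^bsub>G\<^esub> a) = (\<psi> z a)\<^sup>2" for z
    using aG by (simp add: chi_mult power2_eq_square)
  have "revival V E \<alpha> \<beta> (g, 0) (h, 0) t \<longleftrightarrow>
      a \<noteq> \<one>\<^bsub>G\<^esub> \<and> ?spec (\<lambda>z. \<alpha> + \<beta> * \<psi> z a) \<and> (cmod \<alpha>)\<^sup>2 + (cmod \<beta>)\<^sup>2 = 1"
    using revival_iff_eigenvalues[OF assms(13,14), of t \<alpha> \<beta>] assms(13,14)
    by (auto simp: revival_def a_one a_def[symmetric] sc_verts_def)
  also have "\<dots> \<longleftrightarrow> ord a = 2 \<and> ?spec (\<lambda>z. \<alpha> + \<beta> * \<psi> z a)"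
  proof (intro iffI; elim conjE)
    assume a1: "a \<noteq> \<one>\<^bsub>G\<^esub>" and spec: "?spec (\<lambda>z. \<alpha> + \<beta> * \<psi> z a)"
      and norm: "(cmod \<alpha>)\<^sup>2 + (cmod \<beta>)\<^sup>2 = 1"
    have unit: "cmod (\<alpha> + \<beta> * \<psi> z a) = 1" if "z \<in> carrier G" for z
      using spec that norm_exp_eig_plus[of t z] by metis
    have "cmod (\<alpha> + \<beta>) = 1"
      using unit[of "\<one>\<^bsub>G\<^esub>"] by (simp add: chi_commute[of _ _ _ "\<one>\<^bsub>G\<^esub>"])
    then have "(\<psi> z a)\<^sup>2 = 1" if "z \<in> carrier G" for z
      using unimodular_combination_imp_real[OF _ unit[OF that] norm] assms(11,12) by simp
    then have "a \<otimes>\<^bsub>G\<^esub> a = \<one>\<^bsub>G\<^esub>"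
      using chi_separates[of "a \<otimes>\<^bsub>G\<^esub> a"] aG by (simp add: sq)
    then show "ord a = 2 \<and> ?spec (\<lambda>z. \<alpha> + \<beta> * \<psi> z a)"
      using spec a1 ord_eq_2_iff[OF aG] by blast
  next
    assume "ord a = 2" and spec: "?spec (\<lambda>z. \<alpha> + \<beta> * \<psi> z a)"
    then have a: "a \<noteq> \<one>\<^bsub>G\<^esub>" "a \<otimes>\<^bsub>G\<^esub> a = \<one>\<^bsub>G\<^esub>"
      using ord_eq_2_iff[OF aG] by auto
    \<comment> \<open>Conversely the normalisation must be recovered: such a \<open>w\<close> gives
      \<open>cmod (\<alpha> - \<beta>) = 1\<close>, the trivial character gives
      \<open>cmod (\<alpha> + \<beta>) = 1\<close>, and the parallelogram law finishes.\<close>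
    obtain w where w: "w \<in> carrier G" "\<psi> w a \<noteq> 1"
      using chi_separates[OF aG] a(1) by blast
    moreover have "(\<psi> w a)\<^sup>2 = 1" using sq[of w] a(2) by simp
    ultimately have "\<psi> w a = - 1" by (simp add: power2_eq_1_iff)
    then have "cmod (\<alpha> - \<beta>) = 1"
      using spec w(1) norm_exp_eig_plus[of t w] by simp
    moreover have "cmod (\<alpha> + \<beta>) = 1"
      using spec norm_exp_eig_plus[of t "\<one>\<^bsub>G\<^esub>"] by (simp add: chi_commute[of _ _ _ "\<one>\<^bsub>G\<^esub>"])
    ultimately have "(cmod \<alpha>)\<^sup>2 + (cmod \<beta>)\<^sup>2 = 1"
      using cmod_add_power2[of \<alpha> \<beta>] cmod_add_power2[of \<alpha> "- \<beta>"] by simp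
    then show "a \<noteq> \<one>\<^bsub>G\<^esub> \<and> ?spec (\<lambda>z. \<alpha> + \<beta> * \<psi> z a) \<and> (cmod \<alpha>)\<^sup>2 + (cmod \<beta>)\<^sup>2 = 1"
      using spec a(1) by blast
  qed
  finally have rev: "revival V E \<alpha> \<beta> (g, 0) (h, 0) t \<longleftrightarrow>
      ord a = 2 \<and> ?spec (\<lambda>z. \<alpha> + \<beta> * \<psi> z a)" .
  have even: "even (order G)" if "ord a = 2"
    using ord_dvd_group_order[OF aG] that by simp
  \<comment> \<open>Hence \<open>G0\<close> and \<open>G1\<close> together exhaust the group, so the
    conditions on them cover every \<open>z\<close>.\<close>
  have sign: "\<psi> z a = 1 \<or> \<psi> z a = - 1" if "ord a = 2" for z
    using that sq[of z] ord_eq_2_iff[OF aG] by (simp add: power2_eq_1_iff)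
  have "?spec (\<lambda>z. \<alpha> + \<beta> * \<psi> z a) \<longleftrightarrow>
      (\<forall>z\<in>{z \<in> carrier G. \<psi> z a = 1}. exp (\<i> * of_real t * lam_plus z) = \<alpha> + \<beta>) \<and>
      (\<forall>z\<in>{z \<in> carrier G. \<psi> z a = - 1}. exp (\<i> * of_real t * lam_plus z) = \<alpha> - \<beta>) \<and>
      (\<forall>z\<in>{z \<in> carrier G. \<psi> z a = 1} - {z \<in> carrier G. \<Psi> z S = 0}.
        exp (\<i> * of_real t * lam_minus z) = \<alpha> + \<beta>) \<and>
      (\<forall>z\<in>{z \<in> carrier G. \<psi> z a = - 1} - {z \<in> carrier G. \<Psi> z S = 0}.
        exp (\<i> * of_real t * lam_minus z) = \<alpha> - \<beta>)" (is "_ \<longleftrightarrow> ?split") if "ord a = 2"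
  proof
    assume "?spec (\<lambda>z. \<alpha> + \<beta> * \<psi> z a)"
    then show ?split by simp
  next
    assume split: ?split
    show "?spec (\<lambda>z. \<alpha> + \<beta> * \<psi> z a)"
    proof
      fix z assume "z \<in> carrier G"
      then show "exp (\<i> * of_real t * lam_plus z) = \<alpha> + \<beta> * \<psi> z a \<and>
          (\<Psi> z S \<noteq> 0 \<longrightarrow> exp (\<i> * of_real t * lam_minus z) = \<alpha> + \<beta> * \<psi> z a)"
        using sign[OF that, of z] split by auto
    qed
  qed
  then show ?thesis
    unfolding Let_def a_def[symmetric] rev using even by blast
qed

end
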